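(* For a prime power $q$, let $\mathbb{F}_q$ be the finite field with $q$ elements. As $q\to\infty$ (through prime powers): (1) almost all subsets of $M_2(\mathbb{F}_q)$ are purely core, that is, $$\frac{\#\{\text{purely core subsets of } M_2(\mathbb{F}_q)\}}{\#\{\text{subsets of } M_2(\mathbb{F}_q)\}}\to 1;$$ (2) almost all core subsets of $M_2(\mathbb{F}_q)$ are purely core, that is, $$\frac{\#\{\text{purely core subsets of } M_2(\mathbb{F}_q)\}}{\#\{\text{core subsets of } M_2(\mathbb{F}_q)\}}\to 1;$$ (3) almost all subsets of $M_2(\mathbb{F}_q)$ are core, that is, $$\frac{\#\{\text{core subsets of } M_2(\mathbb{F}_q)\}}{\#\{\text{subsets of } M_2(\mathbb{F}_q)\}}\to 1.$$
   Context: $M_2(\mathbb{F}_q)$ is the ring of $2\times 2$ matrices over $\mathbb{F}_q$. In the polynomial ring $M_2(\mathbb{F}_q)[x]$ the variable $x$ commutes with all coefficients, and polynomials are evaluated from the right: for $f=\sum_i \alpha_i x^i$ with $\alpha_i\in M_2(\mathbb{F}_q)$ and $A\in M_2(\mathbb{F}_q)$, $f(A)=\sum_i \alpha_i A^i$. For $S\subseteq M_2(\mathbb{F}_q)$, the null ideal of $S$ is $N(S)=\{f\in M_2(\mathbb{F}_q)[x] \mid f(A)=0 \text{ for all } A\in S\}$. The set $S$ is called core if $N(S)$ is a two-sided ideal of $M_2(\mathbb{F}_q)[x]$, and noncore otherwise. The empty set is core. For a monic polynomial $m\in\mathbb{F}_q[x]$, the minimal polynomial class $\mathcal{C}(m)$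 is the set of matrices in $M_2(\mathbb{F}_q)$ whose minimal polynomial is $m$. A set $S\subseteq M_2(\mathbb{F}_q)$ is called purely core if $S\cap\mathcal{C}$ is core for all minimal polynomial classes $\mathcal{C}$. (Every purely core set is core.) *)

theory Defs
  imports
    "HOL-Analysis.Finite_Cartesian_Product"
    "HOL-Number_Theory.Prime_Powers"
    "HOL-Algebra.UnivPoly"
begin

text \<open>The library has no record-based matrix ring; \<^typ>\<open>2\<close> is the two-element index type.\<close>

definition mat2_ring :: "('a, 'm) ring_scheme \<Rightarrow> ('a ^ 2 ^ 2) ring" where
  "mat2_ring R = \<lparr>
     carrier = {A. \<forall>i j. A $ i $ j \<in> carrier R},
     mult = (\<lambda>A B. \<chi> i j. \<Oplus>\<^bsub>R\<^esub>k\<in>UNIV. A $ i $ k \<otimes>\<^bsub>R\<^esub> B $ k $ j),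
     one = (\<chi> i j. if i = j then \<one>\<^bsub>R\<^esub> else \<zero>\<^bsub>R\<^esub>),
     zero = (\<chi> i j. \<zero>\<^bsub>R\<^esub>),
     add = (\<lambda>A B. \<chi> i j. A $ i $ j \<oplus>\<^bsub>R\<^esub> B $ i $ j)\<rparr>"

definition scalar_mat2 :: "('a, 'm) ring_scheme \<Rightarrow> 'a \<Rightarrow> 'a ^ 2 ^ 2" where
  "scalar_mat2 R a = (\<chi> i j. if i = j then a else \<zero>\<^bsub>R\<^esub>)"

text \<open>
  \<^term>\<open>UP\<close> does not need commutative coefficients, and \<^term>\<open>eval\<close> sums the coefficient times the
  power of the point, in this order, which is the right evaluation.
\<close>

definition null_ideal :: "('a, 'm) ring_scheme \<Rightarrow> ('a ^ 2 ^ 2) set \<Rightarrow> (nat \<Rightarrow> 'a ^ 2 ^ 2) set" where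
  "null_ideal R S = {f \<in> carrier (UP (mat2_ring R)).
     \<forall>A\<in>S. eval (mat2_ring R) (mat2_ring R) id A f = \<zero>\<^bsub>mat2_ring R\<^esub>}"

text \<open>The locale predicate \<^term>\<open>ideal\<close> means two-sided ideal.\<close>

definition core :: "('a, 'm) ring_scheme \<Rightarrow> ('a ^ 2 ^ 2) set \<Rightarrow> bool" where
  "core R S \<longleftrightarrow> ideal (null_ideal R S) (UP (mat2_ring R))"

definition monic :: "('a, 'm) ring_scheme \<Rightarrow> (nat \<Rightarrow> 'a) \<Rightarrow> bool" where
  "monic R m \<longleftrightarrow> m \<in> carrier (UP R) \<and> coeff (UP R) m (deg R m) = \<one>\<^bsub>R\<^esub>"

definition is_min_poly :: "('a, 'm) ring_scheme \<Rightarrow> 'a ^ 2 ^ 2 \<Rightarrow> (nat \<Rightarrow> 'a) \<Rightarrow> bool" where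
  "is_min_poly R A m \<longleftrightarrow>
     monic R m \<and> eval R (mat2_ring R) (scalar_mat2 R) A m = \<zero>\<^bsub>mat2_ring R\<^esub> \<and>
     (\<forall>g. monic R g \<and> eval R (mat2_ring R) (scalar_mat2 R) A g = \<zero>\<^bsub>mat2_ring R\<^esub>
        \<longrightarrow> deg R m \<le> deg R g)"

definition min_poly_class :: "('a, 'm) ring_scheme \<Rightarrow> (nat \<Rightarrow> 'a) \<Rightarrow> ('a ^ 2 ^ 2) set" where
  "min_poly_class R m = {A \<in> carrier (mat2_ring R). is_min_poly R A m}"

definition purely_core :: "('a, 'm) ring_scheme \<Rightarrow> ('a ^ 2 ^ 2) set \<Rightarrow> bool" where
  "purely_core R S \<longleftrightarrow> (\<forall>m. monic R m \<longrightarrow> core R (S \<inter> min_poly_class R m))"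

definition core_subsets :: "('a, 'm) ring_scheme \<Rightarrow> ('a ^ 2 ^ 2) set set" where
  "core_subsets R = {S. S \<subseteq> carrier (mat2_ring R) \<and> core R S}"

definition purely_core_subsets :: "('a, 'm) ring_scheme \<Rightarrow> ('a ^ 2 ^ 2) set set" where
  "purely_core_subsets R = {S. S \<subseteq> carrier (mat2_ring R) \<and> purely_core R S}"

text \<open>The limit \<open>q \<rightarrow> \<infinity>\<close> through prime powers.\<close>

definition at_top_primepow :: "nat filter" where
  "at_top_primepow = inf at_top (principal {q. primepow q})"

end

theory Submission
  imports Defs "HOL-Analysis.Cartesian_Space" "HOL-Real_Asymp.Real_Asymp"
begin

text \<open>
  If all elements of \<open>T\<close> have the same quadratic minimal polynomial, then \<open>f (A) = U A + V\<close> on \<open>T\<close>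
  with \<open>U\<close>, \<open>V\<close> depending linearly on the coefficients of \<open>f\<close>. When two elements of \<open>T\<close> have an
  invertible difference, \<open>f\<close> vanishes on \<open>T\<close> only if \<open>U = V = 0\<close>, and this condition is stable under
  multiplication of \<open>f\<close> on the right by constant matrices, so \<open>T\<close> is core. For \<open>q \<ge> 3\<close> every
  quadratic minimal polynomial class contains \<open>q - 1\<close> matrices with pairwise invertible differences:
  fix the diagonal so that the product of the off-diagonal entries is a nonzero constant. A set that
  is not purely core therefore meets one of these \<open>q\<^sup>2\<close> families in at most one matrix, and the
  proportion of such sets is at most \<open>q\<^sup>2 \<cdot> q / 2 ^ (q - 1)\<close>.
\<close>

subsection \<open>Right evaluation over a noncommutative ring\<close>

context UP_ring
begin

text \<open>Coefficients above the degree vanish, so any larger bound gives the same sum. A common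
  bound lets the values of different polynomials be added term by term.\<close>

lemma eval_le:
  assumes p: "p \<in> carrier P" and A: "A \<in> carrier R" and n: "deg R p \<le> n"
  shows "eval R R id A p = (\<Oplus>i\<in>{..n}. coeff P p i \<otimes> A [^] i)"
proof -
  have "(\<Oplus>i\<in>{..n}. coeff P p i \<otimes> A [^] i) = (\<Oplus>i\<in>{..deg R p}. coeff P p i \<otimes> A [^] i)"
    using p A n by (intro R.add.finprod_mono_neutral_cong_right) (auto simp: deg_aboveD)
  then show ?thesis
    using p by (simp add: eval_on_carrier P_def)
qed

lemma eval_closed:
  assumes p: "p \<in> carrier P" and A: "A \<in> carrier R"
  shows "eval R R id A p \<in> carrier R"
  unfolding eval_le[OF p A le_refl] using p A by (intro R.finsum_closed) auto

lemma eval_add: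
  assumes p: "p \<in> carrier P" and q: "q \<in> carrier P" and A: "A \<in> carrier R"
  shows "eval R R id A (p \<oplus>\<^bsub>P\<^esub> q) = eval R R id A p \<oplus> eval R R id A q"
proof -
  let ?n = "max (deg R p) (deg R q)"
  have "eval R R id A (p \<oplus>\<^bsub>P\<^esub> q)
      = (\<Oplus>i\<in>{..?n}. coeff P p i \<otimes> A [^] i \<oplus> coeff P q i \<otimes> A [^] i)"
    using p q A by (subst eval_le[of _ _ ?n]) (auto simp: R.l_distr intro!: R.add.finprod_cong')
  also have "\<dots> = (\<Oplus>i\<in>{..?n}. coeff P p i \<otimes> A [^] i) \<oplus> (\<Oplus>i\<in>{..?n}. coeff P q i \<otimes> A [^] i)"
    using p q A by (intro R.finsum_addf) auto
  finally show ?thesis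
    using p q A by (simp add: eval_le[of _ _ ?n])
qed

lemma eval_monom:
  assumes a: "a \<in> carrier R" and A: "A \<in> carrier R"
  shows "eval R R id A (monom P a n) = a \<otimes> A [^] n"
proof -
  have "eval R R id A (monom P a n) = (\<Oplus>i\<in>{..n}. if n = i then a \<otimes> A [^] i else \<zero>)"
    using a A by (subst eval_le[of _ _ n]) (auto intro!: R.add.finprod_cong' simp: deg_monom_le)
  also have "\<dots> = a \<otimes> A [^] n"
    using a A by (intro R.finsum_singleton) auto
  finally show ?thesis .
qed

lemma eval_zero:
  assumes A: "A \<in> carrier R"
  shows "eval R R id A \<zero>\<^bsub>P\<^esub> = \<zero>"
  using eval_monom[OF R.zero_closed A, of 0] A by simp

lemma eval_finsum:
  assumes "finite I" "f \<in> I \<rightarrow> carrier P" "A \<in> carrier R"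
  shows "eval R R id A (finsum P f I) = (\<Oplus>i\<in>I. eval R R id A (f i))"
  using assms
proof (induct I rule: finite_induct)
  case empty
  then show ?case by (simp only: P.finsum_empty R.finsum_empty eval_zero)
next
  case (insert x I)
  then have "(\<lambda>i. eval R R id A (f i)) \<in> I \<rightarrow> carrier R" "f \<in> I \<rightarrow> carrier P"
    by (auto intro!: eval_closed)
  with insert have "eval R R id A (finsum P f (insert x I))
      = eval R R id A (f x) \<oplus> eval R R id A (finsum P f I)"
    by (subst P.finsum_insert) (auto intro!: eval_add)
  moreover have "eval R R id A (finsum P f I) = (\<Oplus>i\<in>I. eval R R id A (f i))"
    using insert by blast
  ultimately show ?case
    using insert.hyps insert.prems by (subst R.finsum_insert) (auto intro!: eval_closed)
qed

text \<open>Evaluation is not multiplicative here. Still, a x^i times b x^j evaluates to a b A^(i+j)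
  = a (b A^j) A^i, and summing over j leaves q(A) intact in the middle. So a product vanishes at A
  as soon as its right factor does.\<close>

lemma eval_mult_left:
  assumes p: "p \<in> carrier P" and q: "q \<in> carrier P" and A: "A \<in> carrier R"
  shows "eval R R id A (p \<otimes>\<^bsub>P\<^esub> q)
    = (\<Oplus>i\<in>{..deg R p}. coeff P p i \<otimes> eval R R id A q \<otimes> A [^] i)"
proof -
  have mon: "eval R R id A (monom P a i \<otimes>\<^bsub>P\<^esub> q) = a \<otimes> eval R R id A q \<otimes> A [^] i"
    if a: "a \<in> carrier R" for a i
  proof -
    have "monom P a i \<otimes>\<^bsub>P\<^esub> q
        = monom P a i \<otimes>\<^bsub>P\<^esub> (\<Oplus>\<^bsub>P\<^esub>j\<in>{..deg R q}. monom P (coeff P q j) j)"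
      using q by (simp add: up_repr)
    also have "\<dots> = (\<Oplus>\<^bsub>P\<^esub>j\<in>{..deg R q}. monom P (a \<otimes> coeff P q j) (i + j))"
      using q a by (subst P.finsum_rdistr) (auto intro!: P.add.finprod_cong')
    finally have "eval R R id A (monom P a i \<otimes>\<^bsub>P\<^esub> q)
        = eval R R id A (\<Oplus>\<^bsub>P\<^esub>j\<in>{..deg R q}. monom P (a \<otimes> coeff P q j) (i + j))"
      by simp
    also have "\<dots> = (\<Oplus>j\<in>{..deg R q}. a \<otimes> coeff P q j \<otimes> A [^] (i + j))"
      using q a A by (subst eval_finsum) (auto simp: eval_monom simp del: monom_mult intro!: R.add.finprod_cong')
    also have "\<dots> = (\<Oplus>j\<in>{..deg R q}. a \<otimes> (coeff P q j \<otimes> A [^] j) \<otimes> A [^] i)"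
      using q a A by (auto intro!: R.add.finprod_cong' simp: R.m_assoc R.nat_pow_mult add.commute)
    also have "\<dots> = a \<otimes> (\<Oplus>j\<in>{..deg R q}. coeff P q j \<otimes> A [^] j) \<otimes> A [^] i"
      using q a A by (simp add: R.finsum_ldistr R.finsum_rdistr Pi_iff)
    finally show ?thesis
      using q A by (simp add: eval_le[OF _ _ le_refl])
  qed
  have "p \<otimes>\<^bsub>P\<^esub> q = (\<Oplus>\<^bsub>P\<^esub>i\<in>{..deg R p}. monom P (coeff P p i) i) \<otimes>\<^bsub>P\<^esub> q"
    using p by (simp add: up_repr)
  also have "\<dots> = (\<Oplus>\<^bsub>P\<^esub>i\<in>{..deg R p}. monom P (coeff P p i) i \<otimes>\<^bsub>P\<^esub> q)"
    using p q by (intro P.finsum_ldistr) auto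
  finally have "eval R R id A (p \<otimes>\<^bsub>P\<^esub> q)
      = eval R R id A (\<Oplus>\<^bsub>P\<^esub>i\<in>{..deg R p}. monom P (coeff P p i) i \<otimes>\<^bsub>P\<^esub> q)"
    by simp
  also have "\<dots> = (\<Oplus>i\<in>{..deg R p}. coeff P p i \<otimes> eval R R id A q \<otimes> A [^] i)"
    using p q A by (subst eval_finsum) (auto simp: mon eval_closed intro!: R.add.finprod_cong')
  finally show ?thesis .
qed

text \<open>The same product, grouped by the coefficients of the right factor. Each inner sum is the
  value at A of p multiplied on the right by the constant \<open>coeff P q j\<close>.\<close>

lemma eval_mult_right:
  assumes p: "p \<in> carrier P" and q: "q \<in> carrier P" and A: "A \<in> carrier R"
  shows "eval R R id A (p \<otimes>\<^bsub>P\<^esub> q)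
    = (\<Oplus>j\<in>{..deg R q}. (\<Oplus>i\<in>{..deg R p}. coeff P p i \<otimes> coeff P q j \<otimes> A [^] i) \<otimes> A [^] j)"
proof -
  have mon: "eval R R id A (p \<otimes>\<^bsub>P\<^esub> monom P b j) = (\<Oplus>i\<in>{..deg R p}. coeff P p i \<otimes> b \<otimes> A [^] i) \<otimes> A [^] j"
    if b: "b \<in> carrier R" for b j
  proof -
    have "eval R R id A (p \<otimes>\<^bsub>P\<^esub> monom P b j)
        = (\<Oplus>i\<in>{..deg R p}. coeff P p i \<otimes> (b \<otimes> A [^] j) \<otimes> A [^] i)"
      using p b A by (simp add: eval_mult_left eval_monom)
    also have "\<dots> = (\<Oplus>i\<in>{..deg R p}. coeff P p i \<otimes> b \<otimes> A [^] i \<otimes> A [^] j)"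
      using p b A by (intro R.add.finprod_cong') (auto simp: R.m_assoc R.nat_pow_mult add.commute)
    also have "\<dots> = (\<Oplus>i\<in>{..deg R p}. coeff P p i \<otimes> b \<otimes> A [^] i) \<otimes> A [^] j"
      using p b A by (simp add: R.finsum_ldistr Pi_iff)
    finally show ?thesis .
  qed
  have "p \<otimes>\<^bsub>P\<^esub> q = p \<otimes>\<^bsub>P\<^esub> (\<Oplus>\<^bsub>P\<^esub>j\<in>{..deg R q}. monom P (coeff P q j) j)"
    using q by (simp add: up_repr)
  also have "\<dots> = (\<Oplus>\<^bsub>P\<^esub>j\<in>{..deg R q}. p \<otimes>\<^bsub>P\<^esub> monom P (coeff P q j) j)"
    using p q by (intro P.finsum_rdistr) auto
  finally have "eval R R id A (p \<otimes>\<^bsub>P\<^esub> q)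
      = eval R R id A (\<Oplus>\<^bsub>P\<^esub>j\<in>{..deg R q}. p \<otimes>\<^bsub>P\<^esub> monom P (coeff P q j) j)"
    by simp
  also have "\<dots>
      = (\<Oplus>j\<in>{..deg R q}. (\<Oplus>i\<in>{..deg R p}. coeff P p i \<otimes> coeff P q j \<otimes> A [^] i) \<otimes> A [^] j)"
    using p q A by (subst eval_finsum) (auto simp: mon intro!: R.add.finprod_cong' R.finsum_closed)
  finally show ?thesis .
qed

section \<open>Null ideals over an arbitrary coefficient ring, and criteria for
  two-sidedness\<close>

definition vanishing :: "'a set \<Rightarrow> (nat \<Rightarrow> 'a) set" where
  "vanishing T = {f \<in> carrier P. \<forall>A\<in>T. eval R R id A f = \<zero>}"

text \<open>Absorption from the left is automatic by \<open>eval_mult_left\<close>. Since x is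
  central, absorption from the right needs to be checked only for constants a: the sum in
  \<open>right\<close> is the value at A of f times a.\<close>

lemma ideal_vanishing:
  assumes T: "T \<subseteq> carrier R"
    and right: "\<And>f a A. f \<in> vanishing T \<Longrightarrow> a \<in> carrier R \<Longrightarrow> A \<in> T \<Longrightarrow>
      (\<Oplus>i\<in>{..deg R f}. coeff P f i \<otimes> a \<otimes> A [^] i) = \<zero>"
  shows "ideal (vanishing T) P"
proof (rule idealI)
  show "ring P"
    by (rule UP_ring)
  have left_mult: "x \<otimes>\<^bsub>P\<^esub> f \<in> vanishing T" if f: "f \<in> vanishing T" and x: "x \<in> carrier P" for f x
  proof -
    have "eval R R id A (x \<otimes>\<^bsub>P\<^esub> f) = \<zero>" if "A \<in> T" for A
    proof -
      have A: "A \<in> carrier R" and "eval R R id A f = \<zero>" "f \<in> carrier P"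
        using f that T by (auto simp: vanishing_def)
      then show ?thesis
        using x by (simp add: eval_mult_left)
    qed
    with f x show ?thesis by (simp add: vanishing_def)
  qed
  then show "x \<otimes>\<^bsub>P\<^esub> f \<in> vanishing T" if "f \<in> vanishing T" "x \<in> carrier P" for f x
    using that .
  show "f \<otimes>\<^bsub>P\<^esub> x \<in> vanishing T" if f: "f \<in> vanishing T" and x: "x \<in> carrier P" for f x
  proof -
    have "eval R R id A (f \<otimes>\<^bsub>P\<^esub> x) = \<zero>" if "A \<in> T" for A
    proof -
      have A: "A \<in> carrier R" and "f \<in> carrier P"
        using f that T by (auto simp: vanishing_def)
      then show ?thesis
        using x by (simp add: eval_mult_right right[OF f _ that])
    qed
    with f x show ?thesis by (simp add: vanishing_def)
  qed
  show "subgroup (vanishing T) (add_monoid P)"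
  proof (rule P.add.subgroupI)
    show "vanishing T \<subseteq> carrier P"
      by (auto simp: vanishing_def)
    show "vanishing T \<noteq> {}"
      using T by (auto simp: vanishing_def intro!: exI[of _ "\<zero>\<^bsub>P\<^esub>"] eval_zero)
    show "\<ominus>\<^bsub>P\<^esub> f \<in> vanishing T" if "f \<in> vanishing T" for f
    proof -
      \<comment> \<open>Negation is a left multiplication by -1, so closure under it follows from
        \<open>left_mult\<close>.\<close>
      have "\<ominus>\<^bsub>P\<^esub> f = (\<ominus>\<^bsub>P\<^esub> \<one>\<^bsub>P\<^esub>) \<otimes>\<^bsub>P\<^esub> f"
        using that by (simp add: vanishing_def P.l_minus)
      then show ?thesis
        using left_mult[OF that, of "\<ominus>\<^bsub>P\<^esub> \<one>\<^bsub>P\<^esub>"] by simp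
    qed
    show "f \<oplus>\<^bsub>P\<^esub> g \<in> vanishing T" if "f \<in> vanishing T" "g \<in> vanishing T" for f g
      using that T by (auto simp: vanishing_def eval_add subset_iff)
  qed
qed

text \<open>A constant a commutes with all powers of a central A, hence f times a has value f(A) a
  at A.\<close>

lemma ideal_vanishing_central:
  assumes T: "T \<subseteq> carrier R"
    and comm: "\<And>A a. A \<in> T \<Longrightarrow> a \<in> carrier R \<Longrightarrow> a \<otimes> A = A \<otimes> a"
  shows "ideal (vanishing T) P"
proof (rule ideal_vanishing[OF T])
  fix f a A
  assume f: "f \<in> vanishing T" and a: "a \<in> carrier R" and "A \<in> T"
  then have A: "A \<in> carrier R" and f0: "f \<in> carrier P" "eval R R id A f = \<zero>"
    using T by (auto simp: vanishing_def)
  have pow: "a \<otimes> A [^] (i::nat) = A [^] i \<otimes> a" for i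
    using R.group_commutes_pow[OF comm[OF \<open>A \<in> T\<close> a, symmetric] A a] by simp
  have "(\<Oplus>i\<in>{..deg R f}. coeff P f i \<otimes> a \<otimes> A [^] i)
      = (\<Oplus>i\<in>{..deg R f}. coeff P f i \<otimes> A [^] i \<otimes> a)"
    using f0 A a by (intro R.add.finprod_cong') (auto simp: R.m_assoc pow)
  also have "\<dots> = eval R R id A f \<otimes> a"
    unfolding eval_le[OF f0(1) A le_refl] using f0 A a by (subst R.finsum_ldistr) auto
  finally show "(\<Oplus>i\<in>{..deg R f}. coeff P f i \<otimes> a \<otimes> A [^] i) = \<zero>"
    using f0 a by simp
qed

text \<open>The powers of a root of a monic quadratic are central combinations of that root and \<open>\<one>\<close>,
  with coefficients that depend only on the quadratic.\<close>

lemma ideal_vanishing_quadratic: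
  assumes T: "T \<subseteq> carrier R"
    and c: "c \<in> carrier R" "d \<in> carrier R"
    and comm: "\<And>a. a \<in> carrier R \<Longrightarrow> a \<otimes> c = c \<otimes> a" "\<And>a. a \<in> carrier R \<Longrightarrow> a \<otimes> d = d \<otimes> a"
    and quad: "\<And>A. A \<in> T \<Longrightarrow> A \<otimes> A = c \<otimes> A \<oplus> d"
    and lin: "\<And>\<alpha> \<beta>. \<alpha> \<in> carrier R \<Longrightarrow> \<beta> \<in> carrier R \<Longrightarrow> (\<And>A. A \<in> T \<Longrightarrow> \<alpha> \<otimes> A \<oplus> \<beta> = \<zero>) \<Longrightarrow> \<alpha> = \<zero> \<and> \<beta> = \<zero>"
  shows "ideal (vanishing T) P"
proof -
  \<comment> \<open>\<open>Z\<close> is the centre of the coefficient ring. Keeping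
    \<open>u i\<close> and \<open>v i\<close> in it lets them move past an arbitrary constant a
    later on.\<close>
  define Z where "Z = {z \<in> carrier R. \<forall>a\<in>carrier R. a \<otimes> z = z \<otimes> a}"
  have Z_I: "z \<in> Z" if "z \<in> carrier R" "\<And>a. a \<in> carrier R \<Longrightarrow> a \<otimes> z = z \<otimes> a" for z
    unfolding Z_def using that by blast
  have Z: "z \<in> carrier R" "a \<in> carrier R \<Longrightarrow> a \<otimes> z = z \<otimes> a" if "z \<in> Z" for z a
    using that unfolding Z_def by blast+
  have Z_mult: "x \<otimes> y \<in> Z" if "x \<in> Z" "y \<in> Z" for x y
  proof -
    have "a \<otimes> (x \<otimes> y) = x \<otimes> y \<otimes> a" if a: "a \<in> carrier R" for a
      using R.m_assoc[of a x y] R.m_assoc[of x a y] R.m_assoc[of x y a] Z[OF \<open>x \<in> Z\<close>] Z[OF \<open>y \<in> Z\<close>] a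
      by metis
    then show ?thesis
      using that[THEN Z(1)] by (intro Z_I) auto
  qed
  have Z_add: "x \<oplus> y \<in> Z" if "x \<in> Z" "y \<in> Z" for x y
    using that[THEN Z(1)] Z(2)[OF that(1)] Z(2)[OF that(2)] by (intro Z_I) (simp_all add: R.l_distr R.r_distr)
  have Z_01: "\<zero> \<in> Z" "\<one> \<in> Z" and Z_cd: "c \<in> Z" "d \<in> Z"
    by (auto intro!: Z_I c comm)
  \<comment> \<open>The quantifier order matters: u and v serve all A in \<open>T\<close> at once.
    The recursion replaces (u, v) by (u c + v, u d).\<close>
  have "\<exists>u v. u \<in> Z \<and> v \<in> Z \<and> (\<forall>A\<in>T. A [^] i = u \<otimes> A \<oplus> v)" for i :: nat
  proof (induct i)
    case 0
    have "A [^] (0::nat) = \<zero> \<otimes> A \<oplus> \<one>" if "A \<in> T" for A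
      using that T by auto
    then show ?case
      using Z_01 by blast
  next
    case (Suc i)
    then obtain u v where u: "u \<in> Z" and v: "v \<in> Z" and uv: "\<And>A. A \<in> T \<Longrightarrow> A [^] i = u \<otimes> A \<oplus> v"
      by blast
    have "A [^] Suc i = (u \<otimes> c \<oplus> v) \<otimes> A \<oplus> u \<otimes> d" if "A \<in> T" for A
    proof -
      have A: "A \<in> carrier R"
        using that T by auto
      have "A [^] Suc i = u \<otimes> (A \<otimes> A) \<oplus> v \<otimes> A"
        using A u[THEN Z(1)] v[THEN Z(1)] by (simp add: uv[OF that] R.l_distr R.m_assoc)
      also have "\<dots> = (u \<otimes> c \<oplus> v) \<otimes> A \<oplus> u \<otimes> d"
        using A u[THEN Z(1)] v[THEN Z(1)] c unfolding quad[OF that] by (simp add: R.l_distr R.r_distr R.m_assoc R.a_ac)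
      finally show ?thesis .
    qed
    then show ?case
      using Z_mult[OF u Z_cd(2)] Z_add[OF Z_mult[OF u Z_cd(1)] v] by blast
  qed
  then obtain u v where u: "\<And>i. u i \<in> Z" and v: "\<And>i. v i \<in> Z"
    and uv: "\<And>i A. A \<in> T \<Longrightarrow> A [^] (i::nat) = u i \<otimes> A \<oplus> v i"
    by metis
  \<comment> \<open>U x + V is the remainder of f modulo the common quadratic x^2 - c x - d.\<close>
  define U where "U f = (\<Oplus>i\<in>{..deg R f}. coeff P f i \<otimes> u i)" for f
  define V where "V f = (\<Oplus>i\<in>{..deg R f}. coeff P f i \<otimes> v i)" for f
  \<comment> \<open>By centrality of \<open>u i\<close> and \<open>v i\<close>, multiplying f by a
    turns U A + V into U a A + V a. Hence U = V = 0 makes the new value vanish too, and a = 1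
    recovers f(A) itself.\<close>
  have expand: "(\<Oplus>i\<in>{..deg R f}. coeff P f i \<otimes> a \<otimes> A [^] i) = U f \<otimes> (a \<otimes> A) \<oplus> V f \<otimes> a"
    if f: "f \<in> carrier P" and a: "a \<in> carrier R" and "A \<in> T" for f a A
  proof -
    have A: "A \<in> carrier R"
      using that T by auto
    have "coeff P f i \<otimes> a \<otimes> A [^] i = coeff P f i \<otimes> u i \<otimes> (a \<otimes> A) \<oplus> coeff P f i \<otimes> v i \<otimes> a" for i
    proof -
      have "a \<otimes> (u i \<otimes> A) = u i \<otimes> (a \<otimes> A)" "a \<otimes> v i = v i \<otimes> a"
        using R.m_assoc[of a "u i" A] R.m_assoc[of "u i" a A] Z[OF u[of i]] Z[OF v[of i]] a A by metis+
      with f a A Z(1)[OF u[of i]] Z(1)[OF v[of i]] show ?thesis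
        by (simp add: uv[OF \<open>A \<in> T\<close>] R.r_distr R.m_assoc)
    qed
    then have "(\<Oplus>i\<in>{..deg R f}. coeff P f i \<otimes> a \<otimes> A [^] i)
        = (\<Oplus>i\<in>{..deg R f}. coeff P f i \<otimes> u i \<otimes> (a \<otimes> A) \<oplus> coeff P f i \<otimes> v i \<otimes> a)"
      by simp
    also have "\<dots> = (\<Oplus>i\<in>{..deg R f}. coeff P f i \<otimes> u i \<otimes> (a \<otimes> A)) \<oplus> (\<Oplus>i\<in>{..deg R f}. coeff P f i \<otimes> v i \<otimes> a)"
      using f a A Z(1)[OF u] Z(1)[OF v] by (intro R.finsum_addf) auto
    also have "\<dots> = U f \<otimes> (a \<otimes> A) \<oplus> V f \<otimes> a"
      unfolding U_def V_def using f a A Z(1)[OF u] Z(1)[OF v] by (subst (1 2) R.finsum_ldistr) (auto simp: Pi_iff)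
    finally show ?thesis .
  qed
  show ?thesis
  proof (rule ideal_vanishing[OF T])
    fix f a A
    assume f: "f \<in> vanishing T" and a: "a \<in> carrier R" and "A \<in> T"
    then have fP: "f \<in> carrier P" and A: "A \<in> carrier R"
      using T by (auto simp: vanishing_def)
    have UV: "U f \<in> carrier R" "V f \<in> carrier R"
      unfolding U_def V_def using fP Z(1)[OF u] Z(1)[OF v] by (auto intro!: R.finsum_closed)
    have "U f \<otimes> B \<oplus> V f = \<zero>" if "B \<in> T" for B
    proof -
      have B: "B \<in> carrier R" and "eval R R id B f = \<zero>"
        using f that T by (auto simp: vanishing_def)
      then have "(\<Oplus>i\<in>{..deg R f}. coeff P f i \<otimes> \<one> \<otimes> B [^] i) = \<zero>"
        using fP by (simp add: eval_le[OF fP _ le_refl])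
      then show ?thesis
        using expand[OF fP R.one_closed that] B UV by simp
    qed
    then have "U f = \<zero>" "V f = \<zero>"
      using lin[OF UV] by auto
    then show "(\<Oplus>i\<in>{..deg R f}. coeff P f i \<otimes> a \<otimes> A [^] i) = \<zero>"
      using expand[OF fP a \<open>A \<in> T\<close>] a A by simp
  qed
qed

end

subsection \<open>Two-by-two matrices\<close>

definition mat2 :: "'a \<Rightarrow> 'a \<Rightarrow> 'a \<Rightarrow> 'a \<Rightarrow> 'a ^ 2 ^ 2" where
  "mat2 a b c d = (\<chi> i j. if i = 1 then if j = 1 then a else b else if j = 1 then c else d)"

lemma mat2_nth [simp]:
  "mat2 a b c d $ 1 $ 1 = a" "mat2 a b c d $ 1 $ 2 = b"
  "mat2 a b c d $ 2 $ 1 = c" "mat2 a b c d $ 2 $ 2 = d"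
  by (simp_all add: mat2_def)

lemma mat2_eq_iff: "A = B \<longleftrightarrow> A $ 1 $ 1 = B $ 1 $ 1 \<and> A $ 1 $ 2 = B $ 1 $ 2
    \<and> A $ 2 $ 1 = B $ 2 $ 1 \<and> A $ 2 $ 2 = B $ 2 $ 2" for A B :: "'a ^ 2 ^ 2"
  by (auto simp: vec_eq_iff forall_2)

lemma mat2_inject [simp]: "mat2 a b c d = mat2 a' b' c' d' \<longleftrightarrow> a = a' \<and> b = b' \<and> c = c' \<and> d = d'"
  by (simp add: mat2_eq_iff)

lemma mat2_in_carrier [simp]: "mat2 a b c d \<in> carrier (mat2_ring R)
    \<longleftrightarrow> a \<in> carrier R \<and> b \<in> carrier R \<and> c \<in> carrier R \<and> d \<in> carrier R"
  by (auto simp: mat2_ring_def forall_2)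

lemma mat2_cases [elim?]:
  assumes "A \<in> carrier (mat2_ring R)"
  obtains a b c d where "A = mat2 a b c d"
    "a \<in> carrier R" "b \<in> carrier R" "c \<in> carrier R" "d \<in> carrier R"
proof (rule that)
  show "A = mat2 (A $ 1 $ 1) (A $ 1 $ 2) (A $ 2 $ 1) (A $ 2 $ 2)"
    by (simp add: mat2_eq_iff)
qed (use assms in \<open>auto simp: mat2_ring_def\<close>)

lemma mat2_add [simp]: "mat2 a b c d \<oplus>\<^bsub>mat2_ring R\<^esub> mat2 a' b' c' d'
    = mat2 (a \<oplus>\<^bsub>R\<^esub> a') (b \<oplus>\<^bsub>R\<^esub> b') (c \<oplus>\<^bsub>R\<^esub> c') (d \<oplus>\<^bsub>R\<^esub> d')"
  by (simp add: mat2_ring_def mat2_eq_iff)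

lemma mat2_zero: "\<zero>\<^bsub>mat2_ring R\<^esub> = mat2 \<zero>\<^bsub>R\<^esub> \<zero>\<^bsub>R\<^esub> \<zero>\<^bsub>R\<^esub> \<zero>\<^bsub>R\<^esub>"
  by (simp add: mat2_ring_def mat2_eq_iff)

lemma mat2_one: "\<one>\<^bsub>mat2_ring R\<^esub> = mat2 \<one>\<^bsub>R\<^esub> \<zero>\<^bsub>R\<^esub> \<zero>\<^bsub>R\<^esub> \<one>\<^bsub>R\<^esub>"
  by (simp add: mat2_ring_def mat2_eq_iff)

lemma scalar_mat2_eq: "scalar_mat2 R a = mat2 a \<zero>\<^bsub>R\<^esub> \<zero>\<^bsub>R\<^esub> a"
  by (simp add: scalar_mat2_def mat2_eq_iff)

lemma (in ring) mat2_mult [simp]: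
  assumes "a \<in> carrier R" "b \<in> carrier R" "c \<in> carrier R" "d \<in> carrier R"
    and "a' \<in> carrier R" "b' \<in> carrier R" "c' \<in> carrier R" "d' \<in> carrier R"
  shows "mat2 a b c d \<otimes>\<^bsub>mat2_ring R\<^esub> mat2 a' b' c' d'
    = mat2 (a \<otimes> a' \<oplus> b \<otimes> c') (a \<otimes> b' \<oplus> b \<otimes> d') (c \<otimes> a' \<oplus> d \<otimes> c') (c \<otimes> b' \<oplus> d \<otimes> d')"
  using assms by (simp add: mat2_ring_def mat2_eq_iff UNIV_2)

lemma (in ring) ring_mat2: "ring (mat2_ring R)"
proof (rule ringI)
  let ?M = "mat2_ring R"
  show "abelian_group ?M"
  proof (rule abelian_groupI)
    fix A assume "A \<in> carrier ?M"
    then obtain a b c d where A: "A = mat2 a b c d"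
      "a \<in> carrier R" "b \<in> carrier R" "c \<in> carrier R" "d \<in> carrier R" ..
    then show "\<exists>B\<in>carrier ?M. B \<oplus>\<^bsub>?M\<^esub> A = \<zero>\<^bsub>?M\<^esub>"
      by (intro bexI[of _ "mat2 (\<ominus> a) (\<ominus> b) (\<ominus> c) (\<ominus> d)"]) (simp_all add: mat2_zero l_neg)
  qed (auto elim!: mat2_cases simp: mat2_zero a_ac)
  show "monoid ?M"
    by (rule monoidI) (auto elim!: mat2_cases simp: mat2_one l_distr r_distr m_assoc a_ac)
qed (auto elim!: mat2_cases simp: l_distr r_distr a_ac)

context cring
begin

lemma scalar_mat2_commute:
  assumes "A \<in> carrier (mat2_ring R)" "a \<in> carrier R"
  shows "A \<otimes>\<^bsub>mat2_ring R\<^esub> scalar_mat2 R a = scalar_mat2 R a \<otimes>\<^bsub>mat2_ring R\<^esub> A"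
  using assms by (auto elim!: mat2_cases simp: scalar_mat2_eq m_comm)

text \<open>Cayley-Hamilton, solved for the square: the scalars are the trace and minus the
  determinant. This is the shape of the hypothesis \<open>quad\<close> in
  \<open>ideal_vanishing_quadratic\<close>.\<close>

lemma mat2_cayley_hamilton:
  assumes "a \<in> carrier R" "b \<in> carrier R" "c \<in> carrier R" "d \<in> carrier R"
  shows "mat2 a b c d \<otimes>\<^bsub>mat2_ring R\<^esub> mat2 a b c d
    = scalar_mat2 R (a \<oplus> d) \<otimes>\<^bsub>mat2_ring R\<^esub> mat2 a b c d \<oplus>\<^bsub>mat2_ring R\<^esub> scalar_mat2 R (b \<otimes> c \<ominus> a \<otimes> d)"
proof -
  have "a \<otimes> a \<oplus> b \<otimes> c = (a \<oplus> d) \<otimes> a \<oplus> (b \<otimes> c \<ominus> a \<otimes> d)"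
    "a \<otimes> b \<oplus> b \<otimes> d = (a \<oplus> d) \<otimes> b" "c \<otimes> a \<oplus> d \<otimes> c = (a \<oplus> d) \<otimes> c"
    "c \<otimes> b \<oplus> d \<otimes> d = (a \<oplus> d) \<otimes> d \<oplus> (b \<otimes> c \<ominus> a \<otimes> d)"
    using assms by algebra+
  with assms show ?thesis
    by (simp add: scalar_mat2_eq)
qed

text \<open>\<open>k1\<close> and \<open>k0\<close> are the coefficients of the remainder of m
  modulo the characteristic polynomial, and the right-hand side is \<open>k1\<close> A +
  \<open>k0\<close> I written out in entries.\<close>

lemma eval_mat2:
  assumes m: "m \<in> carrier (UP R)" and deg: "deg R m \<le> 2"
    and A: "a \<in> carrier R" "b \<in> carrier R" "c \<in> carrier R" "d \<in> carrier R"
    and k0: "k0 = coeff (UP R) m 0 \<oplus> coeff (UP R) m 2 \<otimes> (b \<otimes> c \<ominus> a \<otimes> d)"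
    and k1: "k1 = coeff (UP R) m 1 \<oplus> coeff (UP R) m 2 \<otimes> (a \<oplus> d)"
  shows "eval R (mat2_ring R) (scalar_mat2 R) (mat2 a b c d) m
    = mat2 (k1 \<otimes> a \<oplus> k0) (k1 \<otimes> b) (k1 \<otimes> c) (k1 \<otimes> d \<oplus> k0)"
proof -
  interpret M: ring "mat2_ring R"
    by (rule ring_mat2)
  interpret UP_ring R "UP R"
    by unfold_locales
  define A where "A = mat2 a b c d"
  define m0 m1 m2 where "m0 = coeff (UP R) m 0" and "m1 = coeff (UP R) m 1" and "m2 = coeff (UP R) m 2"
  have mc: "m0 \<in> carrier R" "m1 \<in> carrier R" "m2 \<in> carrier R"
    using m by (simp_all add: m0_def m1_def m2_def)
  let ?f = "\<lambda>i. scalar_mat2 R (coeff (UP R) m i) \<otimes>\<^bsub>mat2_ring R\<^esub> A [^]\<^bsub>mat2_ring R\<^esub> i"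
  have f: "?f \<in> I \<rightarrow> carrier (mat2_ring R)" for I
    using m A by (auto simp: scalar_mat2_eq A_def intro!: M.m_closed)
  have "eval R (mat2_ring R) (scalar_mat2 R) A m = finsum (mat2_ring R) ?f {..deg R m}"
    using m by (simp add: eval_def)
  \<comment> \<open>Padding with zero terms up to exponent 2 treats degrees 0, 1 and 2
    uniformly.\<close>
  also have "\<dots> = finsum (mat2_ring R) ?f {..Suc (Suc 0)}"
    using f deg m A
    by (intro M.add.finprod_mono_neutral_cong_left)
       (auto simp: deg_aboveD scalar_mat2_eq A_def mat2_zero[of R, symmetric])
  also have "\<dots> = ?f 2 \<oplus>\<^bsub>mat2_ring R\<^esub> (?f 1 \<oplus>\<^bsub>mat2_ring R\<^esub> ?f 0)"
    by (simp only: M.finsum_Suc[OF f] M.finsum_0[OF f] numeral_2_eq_2 One_nat_def)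
  also have "\<dots> = mat2 (k1 \<otimes> a \<oplus> k0) (k1 \<otimes> b) (k1 \<otimes> c) (k1 \<otimes> d \<oplus> k0)"
  proof -
    have AA: "A [^]\<^bsub>mat2_ring R\<^esub> (2::nat) = A \<otimes>\<^bsub>mat2_ring R\<^esub> A"
      using A by (simp add: numeral_2_eq_2 A_def)
    have "m2 \<otimes> (a \<otimes> a \<oplus> b \<otimes> c) \<oplus> (m1 \<otimes> a \<oplus> m0)
        = (m1 \<oplus> m2 \<otimes> (a \<oplus> d)) \<otimes> a \<oplus> (m0 \<oplus> m2 \<otimes> (b \<otimes> c \<ominus> a \<otimes> d))"
      "m2 \<otimes> (a \<otimes> b \<oplus> b \<otimes> d) \<oplus> m1 \<otimes> b = (m1 \<oplus> m2 \<otimes> (a \<oplus> d)) \<otimes> b"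
      "m2 \<otimes> (c \<otimes> a \<oplus> d \<otimes> c) \<oplus> m1 \<otimes> c = (m1 \<oplus> m2 \<otimes> (a \<oplus> d)) \<otimes> c"
      "m2 \<otimes> (c \<otimes> b \<oplus> d \<otimes> d) \<oplus> (m1 \<otimes> d \<oplus> m0)
        = (m1 \<oplus> m2 \<otimes> (a \<oplus> d)) \<otimes> d \<oplus> (m0 \<oplus> m2 \<otimes> (b \<otimes> c \<ominus> a \<otimes> d))"
      using A mc by algebra+
    then show ?thesis
      unfolding AA k0 k1 m0_def[symmetric] m1_def[symmetric] m2_def[symmetric]
      using A mc by (simp add: scalar_mat2_eq A_def mat2_one)
  qed
  finally show ?thesis
    by (simp add: A_def)
qed

end

subsection \<open>Minimal polynomials of two-by-two matrices\<close>

context field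
begin

lemma ex_monic_quadratic:
  assumes t: "t \<in> carrier R" and e: "e \<in> carrier R"
  shows "\<exists>p. monic R p \<and> deg R p = 2 \<and> coeff (UP R) p 1 = t \<and> coeff (UP R) p 0 = e"
proof -
  interpret U: UP_domain R "UP R"
    by unfold_locales
  let ?P = "UP R"
  define p where "p = monom ?P \<one> 2 \<oplus>\<^bsub>?P\<^esub> (monom ?P t 1 \<oplus>\<^bsub>?P\<^esub> monom ?P e 0)"
  have p: "p \<in> carrier ?P"
    using t e by (simp add: p_def)
  have coeff_p: "coeff ?P p n = (if n = 2 then \<one> else if n = 1 then t else if n = 0 then e else \<zero>)" for n
    using t e by (simp add: p_def)
  have "deg R p = 2"
    by (intro antisym U.deg_aboveI U.deg_belowI) (simp_all add: coeff_p p)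
  with p show ?thesis
    by (intro exI[of _ p]) (simp add: monic_def coeff_p)
qed

text \<open>A nonscalar A and the identity are linearly independent, so k1 A + k0 I = 0 forces k1 =
  k0 = 0. The minimal polynomial is therefore the characteristic one, and a class of nonscalar
  matrices is given by trace and determinant.\<close>

lemma is_min_poly_nonscalar:
  assumes A: "a \<in> carrier R" "b \<in> carrier R" "c \<in> carrier R" "d \<in> carrier R"
    and nonscalar: "b \<noteq> \<zero> \<or> c \<noteq> \<zero> \<or> a \<noteq> d"
  shows "is_min_poly R (mat2 a b c d) m \<longleftrightarrow> monic R m \<and> deg R m = 2
    \<and> coeff (UP R) m 1 = \<ominus> (a \<oplus> d) \<and> coeff (UP R) m 0 = a \<otimes> d \<ominus> b \<otimes> c"
proof -
  interpret U: UP_domain R "UP R"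
    by unfold_locales
  let ?P = "UP R"
  let ?ev = "eval R (mat2_ring R) (scalar_mat2 R) (mat2 a b c d)"
  have root_iff: "?ev g = \<zero>\<^bsub>mat2_ring R\<^esub> \<longleftrightarrow> deg R g = 2
      \<and> coeff ?P g 1 = \<ominus> (a \<oplus> d) \<and> coeff ?P g 0 = a \<otimes> d \<ominus> b \<otimes> c"
    if g: "monic R g" and deg: "deg R g \<le> 2" for g
  proof -
    have gP: "g \<in> carrier ?P"
      using g by (simp add: monic_def)
    define g0 g1 g2 where "g0 = coeff ?P g 0" and "g1 = coeff ?P g 1" and "g2 = coeff ?P g 2"
    have gc: "g0 \<in> carrier R" "g1 \<in> carrier R" "g2 \<in> carrier R"
      using gP by (simp_all add: g0_def g1_def g2_def)
    let ?k0 = "g0 \<oplus> g2 \<otimes> (b \<otimes> c \<ominus> a \<otimes> d)" and ?k1 = "g1 \<oplus> g2 \<otimes> (a \<oplus> d)"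
    have k: "?k0 \<in> carrier R" "?k1 \<in> carrier R"
      using A gc by auto
    have "?ev g = \<zero>\<^bsub>mat2_ring R\<^esub> \<longleftrightarrow> ?k1 \<otimes> a \<oplus> ?k0 = \<zero> \<and> ?k1 \<otimes> b = \<zero> \<and> ?k1 \<otimes> c = \<zero> \<and> ?k1 \<otimes> d \<oplus> ?k0 = \<zero>"
      by (simp add: eval_mat2[OF gP deg A refl refl] mat2_zero g0_def g1_def g2_def)
    also have "\<dots> \<longleftrightarrow> ?k1 = \<zero> \<and> ?k0 = \<zero>"
    proof (intro iffI; elim conjE)
      assume *: "?k1 \<otimes> a \<oplus> ?k0 = \<zero>" "?k1 \<otimes> b = \<zero>" "?k1 \<otimes> c = \<zero>" "?k1 \<otimes> d \<oplus> ?k0 = \<zero>"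
      \<comment> \<open>Comparing the diagonal entries gives k1 (a - d) = 0. Together with k1 b = k1
        c = 0 and nonscalarity, k1 has a nonzero cofactor.\<close>
      have "?k1 \<otimes> a = ?k1 \<otimes> d"
        using *(1,4) k A by (metis add.inv_equality m_closed minus_minus)
      then have "?k1 = \<zero>"
        using nonscalar *(2,3) k A m_lcancel integral by metis
      then show "?k1 = \<zero> \<and> ?k0 = \<zero>"
        using * k A by simp
    qed (use A k in simp)
    finally have ev: "?ev g = \<zero>\<^bsub>mat2_ring R\<^esub> \<longleftrightarrow> ?k1 = \<zero> \<and> ?k0 = \<zero>" .
    show ?thesis
    proof (cases "deg R g = 2")
      case True
      then have "g2 = \<one>"
        using g by (simp add: monic_def g2_def)
      moreover have "g1 \<oplus> (a \<oplus> d) = \<zero> \<longleftrightarrow> g1 = \<ominus> (a \<oplus> d)"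
        using A gc by (metis add.inv_equality add.m_closed l_neg)
      moreover have "g0 \<oplus> (b \<otimes> c \<ominus> a \<otimes> d) = \<zero> \<longleftrightarrow> g0 = a \<otimes> d \<ominus> b \<otimes> c"
      proof -
        have "\<ominus> (b \<otimes> c \<ominus> a \<otimes> d) = a \<otimes> d \<ominus> b \<otimes> c"
          using A by algebra
        moreover have "b \<otimes> c \<ominus> a \<otimes> d \<in> carrier R"
          using A by simp
        ultimately show ?thesis
          using gc by (metis add.inv_equality l_neg)
      qed
      ultimately show ?thesis
        using True A gc unfolding ev by (simp add: g0_def g1_def)
    next
      case False
      \<comment> \<open>Below degree 2, k1 and k0 are just \<open>g1\<close> and \<open>g0\<close>,
        and one of these is the leading coefficient 1, so g has no root at the matrix.\<close>
      then have "g2 = \<zero>"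
        using deg gP by (simp add: g2_def U.deg_aboveD)
      moreover have "g1 \<noteq> \<zero> \<or> g0 \<noteq> \<zero>"
      proof -
        have "deg R g = 0 \<or> deg R g = 1"
          using False deg by auto
        then show ?thesis
          using g by (auto simp: monic_def g0_def g1_def)
      qed
      ultimately show ?thesis
        using False A gc unfolding ev by auto
    qed
  qed
  \<comment> \<open>The characteristic polynomial bounds the degree of every minimal polynomial by
    2, which brings it within the range of \<open>root_iff\<close>.\<close>
  obtain p where p: "monic R p" "deg R p = 2"
      "coeff ?P p 1 = \<ominus> (a \<oplus> d)" "coeff ?P p 0 = a \<otimes> d \<ominus> b \<otimes> c"
    using ex_monic_quadratic[of "\<ominus> (a \<oplus> d)" "a \<otimes> d \<ominus> b \<otimes> c"] A by auto
  then have "?ev p = \<zero>\<^bsub>mat2_ring R\<^esub>"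
    using root_iff[of p] by simp
  show ?thesis
  proof
    assume m: "is_min_poly R (mat2 a b c d) m"
    then have "deg R m \<le> 2"
      using p \<open>?ev p = _\<close> by (auto simp: is_min_poly_def)
    with m root_iff[of m] show "monic R m \<and> deg R m = 2
      \<and> coeff ?P m 1 = \<ominus> (a \<oplus> d) \<and> coeff ?P m 0 = a \<otimes> d \<ominus> b \<otimes> c"
      by (simp add: is_min_poly_def)
  next
    assume m: "monic R m \<and> deg R m = 2
      \<and> coeff ?P m 1 = \<ominus> (a \<oplus> d) \<and> coeff ?P m 0 = a \<otimes> d \<ominus> b \<otimes> c"
    moreover have "2 \<le> deg R g" if "monic R g" "?ev g = \<zero>\<^bsub>mat2_ring R\<^esub>" for g
      using root_iff[of g] that by (cases "deg R g \<le> 2") auto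
    ultimately show "is_min_poly R (mat2 a b c d) m"
      using root_iff[of m] by (simp add: is_min_poly_def)
  qed
qed

text \<open>The witness is x - a. No smaller degree is possible, since a monic constant evaluates to
  the identity matrix.\<close>

lemma ex_is_min_poly_scalar:
  assumes a: "a \<in> carrier R"
  shows "\<exists>m. is_min_poly R (scalar_mat2 R a) m \<and> deg R m = 1"
proof -
  interpret U: UP_domain R "UP R"
    by unfold_locales
  let ?P = "UP R"
  define p where "p = monom ?P \<one> 1 \<oplus>\<^bsub>?P\<^esub> monom ?P (\<ominus> a) 0"
  have p: "p \<in> carrier ?P"
    using a by (simp add: p_def)
  have coeff_p: "coeff ?P p n = (if n = 1 then \<one> else if n = 0 then \<ominus> a else \<zero>)" for n
    using a by (simp add: p_def del: U.monom_a_inv U.monom_add)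
  have deg_p: "deg R p = 1"
    by (intro antisym U.deg_aboveI U.deg_belowI) (simp_all add: coeff_p p)
  have "eval R (mat2_ring R) (scalar_mat2 R) (scalar_mat2 R a) p = \<zero>\<^bsub>mat2_ring R\<^esub>"
    using a unfolding scalar_mat2_eq[of R a]
    by (subst eval_mat2[OF p _ _ _ _ _ refl refl]) (auto simp: deg_p coeff_p mat2_zero r_neg)
  moreover have "1 \<le> deg R g"
    if g: "monic R g" and root: "eval R (mat2_ring R) (scalar_mat2 R) (scalar_mat2 R a) g = \<zero>\<^bsub>mat2_ring R\<^esub>" for g
  proof (rule ccontr)
    assume "\<not> 1 \<le> deg R g"
    then have deg: "deg R g = 0" by simp
    have gP: "g \<in> carrier ?P" and g0: "coeff ?P g 0 = \<one>"
      using g deg by (simp_all add: monic_def)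
    have "coeff ?P g 1 = \<zero>" "coeff ?P g 2 = \<zero>"
      using gP deg by (simp_all add: U.deg_aboveD)
    then show False
      using root a unfolding scalar_mat2_eq[of R a]
      by (subst (asm) eval_mat2[OF gP _ _ _ _ _ refl refl]) (auto simp: deg g0 mat2_zero)
  qed
  ultimately show ?thesis
    using p by (intro exI[of _ p]) (simp add: is_min_poly_def monic_def coeff_p deg_p)
qed

text \<open>Nonscalar matrices have a minimal polynomial of degree 2, scalar ones of degree 1. So
  one class never mixes scalar and nonscalar matrices.\<close>

lemma is_min_poly_deg_le_1_iff:
  assumes A: "A \<in> carrier (mat2_ring R)" and m: "is_min_poly R A m"
  shows "deg R m \<le> 1 \<longleftrightarrow> A \<in> scalar_mat2 R ` carrier R"
proof
  obtain a b c d where eq: "A = mat2 a b c d"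
    and car: "a \<in> carrier R" "b \<in> carrier R" "c \<in> carrier R" "d \<in> carrier R"
    using A ..
  show "A \<in> scalar_mat2 R ` carrier R" if "deg R m \<le> 1"
    using is_min_poly_nonscalar[OF car] m that car unfolding eq
    by (fastforce simp: scalar_mat2_eq)
  show "deg R m \<le> 1" if "A \<in> scalar_mat2 R ` carrier R"
    using ex_is_min_poly_scalar that m by (metis imageE is_min_poly_def)
qed

lemma ex_is_min_poly:
  assumes A: "A \<in> carrier (mat2_ring R)"
  shows "\<exists>m. is_min_poly R A m"
proof -
  obtain a b c d where eq: "A = mat2 a b c d"
    and car: "a \<in> carrier R" "b \<in> carrier R" "c \<in> carrier R" "d \<in> carrier R"
    using A ..
  show ?thesis
  proof (cases "b \<noteq> \<zero> \<or> c \<noteq> \<zero> \<or> a \<noteq> d")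
    case True
    then have "\<exists>m. is_min_poly R (mat2 a b c d) m"
      using ex_monic_quadratic[of "\<ominus> (a \<oplus> d)" "a \<otimes> d \<ominus> b \<otimes> c"] car
      by (simp add: is_min_poly_nonscalar)
    then show ?thesis
      using eq by blast
  next
    case False
    then show ?thesis
      using ex_is_min_poly_scalar[OF car(1)] eq by (auto simp: scalar_mat2_eq)
  qed
qed

subsection \<open>Purely core sets\<close>

lemma null_ideal_eq_vanishing: "null_ideal R T = UP_ring.vanishing (mat2_ring R) T"
proof -
  interpret M: UP_ring "mat2_ring R" "UP (mat2_ring R)"
    by (simp add: UP_ring.intro ring_mat2)
  show ?thesis
    by (simp add: null_ideal_def M.vanishing_def)
qed

text \<open>Scalar matrices are central. The case covers the empty set as well.\<close>

lemma core_scalar: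
  assumes T: "T \<subseteq> scalar_mat2 R ` carrier R"
  shows "core R T"
proof -
  interpret M: UP_ring "mat2_ring R" "UP (mat2_ring R)"
    by (simp add: UP_ring.intro ring_mat2)
  show ?thesis
    unfolding core_def null_ideal_eq_vanishing
  proof (rule M.ideal_vanishing_central)
    show "T \<subseteq> carrier (mat2_ring R)"
      using T by (auto simp: scalar_mat2_eq)
    show "a \<otimes>\<^bsub>mat2_ring R\<^esub> A = A \<otimes>\<^bsub>mat2_ring R\<^esub> a" if "A \<in> T" "a \<in> carrier (mat2_ring R)" for A a
      using that T scalar_mat2_commute by blast
  qed
qed

text \<open>The two given matrices have an antidiagonal difference with nonzero entries, hence an
  invertible one. So \<alpha> A + \<beta> = 0 at both forces \<alpha> = 0 and then \<beta> = 0,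
  which is the independence required by \<open>ideal_vanishing_quadratic\<close>.\<close>

lemma core_min_poly_class:
  assumes T: "T \<subseteq> min_poly_class R m"
    and AB: "mat2 a b c d \<in> T" "mat2 a b' c' d \<in> T" and ne: "b \<noteq> b'" "c \<noteq> c'"
  shows "core R T"
proof -
  interpret M: UP_ring "mat2_ring R" "UP (mat2_ring R)"
    by (simp add: UP_ring.intro ring_mat2)
  have car: "a \<in> carrier R" "b \<in> carrier R" "c \<in> carrier R" "d \<in> carrier R" "b' \<in> carrier R" "c' \<in> carrier R"
    using T AB by (auto simp: min_poly_class_def)
  have deg: "\<not> deg R m \<le> 1"
  proof
    assume "deg R m \<le> 1"
    then have "mat2 a b c d \<in> scalar_mat2 R ` carrier R" "mat2 a b' c' d \<in> scalar_mat2 R ` carrier R"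
      using is_min_poly_deg_le_1_iff T AB by (auto simp: min_poly_class_def)
    then show False
      using ne by (auto simp: scalar_mat2_eq)
  qed
  define m0 m1 where "m0 = coeff (UP R) m 0" and "m1 = coeff (UP R) m 1"
  \<comment> \<open>Every matrix in \<open>T\<close> has trace -m1 and determinant m0, so
    Cayley-Hamilton supplies one quadratic for all of \<open>T\<close>.\<close>
  have m1: "m1 = \<ominus> (w \<oplus> z)" and m0: "m0 = w \<otimes> z \<ominus> x \<otimes> y"
    and xyzw: "w \<in> carrier R" "x \<in> carrier R" "y \<in> carrier R" "z \<in> carrier R"
    if "mat2 w x y z \<in> T" for w x y z
  proof -
    have min: "is_min_poly R (mat2 w x y z) m" "mat2 w x y z \<in> carrier (mat2_ring R)"
      using T that by (auto simp: min_poly_class_def)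
    then show xyzw: "w \<in> carrier R" "x \<in> carrier R" "y \<in> carrier R" "z \<in> carrier R"
      by auto
    have "x \<noteq> \<zero> \<or> y \<noteq> \<zero> \<or> w \<noteq> z"
      using is_min_poly_deg_le_1_iff[OF min(2,1)] deg xyzw by (auto simp: scalar_mat2_eq)
    then show "m1 = \<ominus> (w \<oplus> z)" "m0 = w \<otimes> z \<ominus> x \<otimes> y"
      using is_min_poly_nonscalar[OF xyzw] min(1) by (auto simp: m0_def m1_def)
  qed
  show ?thesis
    unfolding core_def null_ideal_eq_vanishing
  proof (rule M.ideal_vanishing_quadratic)
    show "T \<subseteq> carrier (mat2_ring R)"
      using T by (auto simp: min_poly_class_def)
    have mc: "\<ominus> m1 \<in> carrier R" "\<ominus> m0 \<in> carrier R"
      using m1[OF AB(1)] m0[OF AB(1)] car by auto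
    then show "scalar_mat2 R (\<ominus> m1) \<in> carrier (mat2_ring R)" "scalar_mat2 R (\<ominus> m0) \<in> carrier (mat2_ring R)"
      by (simp_all add: scalar_mat2_eq)
    show "A \<otimes>\<^bsub>mat2_ring R\<^esub> scalar_mat2 R (\<ominus> m1) = scalar_mat2 R (\<ominus> m1) \<otimes>\<^bsub>mat2_ring R\<^esub> A"
      "A \<otimes>\<^bsub>mat2_ring R\<^esub> scalar_mat2 R (\<ominus> m0) = scalar_mat2 R (\<ominus> m0) \<otimes>\<^bsub>mat2_ring R\<^esub> A"
      if "A \<in> carrier (mat2_ring R)" for A
      using scalar_mat2_commute that mc by auto
    show "A \<otimes>\<^bsub>mat2_ring R\<^esub> A = scalar_mat2 R (\<ominus> m1) \<otimes>\<^bsub>mat2_ring R\<^esub> A \<oplus>\<^bsub>mat2_ring R\<^esub> scalar_mat2 R (\<ominus> m0)"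
      if "A \<in> T" for A
    proof -
      obtain w x y z where A: "A = mat2 w x y z"
        using \<open>A \<in> T\<close> T by (auto simp: min_poly_class_def elim!: mat2_cases)
      note * = that[unfolded A]
      have "\<ominus> m1 = w \<oplus> z" "\<ominus> m0 = x \<otimes> y \<ominus> w \<otimes> z"
        using xyzw[OF *] unfolding m1[OF *] m0[OF *] by algebra+
      then show ?thesis
        unfolding A using mat2_cayley_hamilton[OF xyzw[OF *]] by simp
    qed
    show "\<alpha> = \<zero>\<^bsub>mat2_ring R\<^esub> \<and> \<beta> = \<zero>\<^bsub>mat2_ring R\<^esub>"
      if \<alpha>: "\<alpha> \<in> carrier (mat2_ring R)" and \<beta>: "\<beta> \<in> carrier (mat2_ring R)"
        and lin: "\<And>A. A \<in> T \<Longrightarrow> \<alpha> \<otimes>\<^bsub>mat2_ring R\<^esub> A \<oplus>\<^bsub>mat2_ring R\<^esub> \<beta> = \<zero>\<^bsub>mat2_ring R\<^esub>" for \<alpha> \<beta>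
    proof -
      obtain p q r s where \<alpha>_eq: "\<alpha> = mat2 p q r s"
        and pqrs: "p \<in> carrier R" "q \<in> carrier R" "r \<in> carrier R" "s \<in> carrier R"
        using \<alpha> ..
      obtain p' q' r' s' where \<beta>_eq: "\<beta> = mat2 p' q' r' s'"
        and pqrs': "p' \<in> carrier R" "q' \<in> carrier R" "r' \<in> carrier R" "s' \<in> carrier R"
        using \<beta> ..
      \<comment> \<open>Cancelling the invertible difference, one entry at a time: the two equations
        differ only in f and f'. The pair c, c' kills q and s, the pair b, b' kills p and r.\<close>
      have cancel: "v = \<zero>"
        if "u \<otimes> e \<oplus> v \<otimes> f \<oplus> w = \<zero>" "u \<otimes> e \<oplus> v \<otimes> f' \<oplus> w = \<zero>" "f \<noteq> f'"
          "u \<in> carrier R" "v \<in> carrier R" "w \<in> carrier R" "e \<in> carrier R" "f \<in> carrier R" "f' \<in> carrier R"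
        for u v w e f f'
      proof -
        have "v \<otimes> f \<oplus> (u \<otimes> e \<oplus> w) = v \<otimes> f' \<oplus> (u \<otimes> e \<oplus> w)"
          using that by (simp add: a_ac)
        then have "v \<otimes> f = v \<otimes> f'"
          using that by simp
        then show ?thesis
          using that m_lcancel by blast
      qed
      have eqs: "p \<otimes> a \<oplus> q \<otimes> c \<oplus> p' = \<zero>" "p \<otimes> b \<oplus> q \<otimes> d \<oplus> q' = \<zero>"
        "r \<otimes> a \<oplus> s \<otimes> c \<oplus> r' = \<zero>" "r \<otimes> b \<oplus> s \<otimes> d \<oplus> s' = \<zero>"
        "p \<otimes> a \<oplus> q \<otimes> c' \<oplus> p' = \<zero>" "p \<otimes> b' \<oplus> q \<otimes> d \<oplus> q' = \<zero>"
        "r \<otimes> a \<oplus> s \<otimes> c' \<oplus> r' = \<zero>" "r \<otimes> b' \<oplus> s \<otimes> d \<oplus> s' = \<zero>"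
        using lin[OF AB(1)] lin[OF AB(2)] pqrs pqrs' car
        by (auto simp: \<alpha>_eq \<beta>_eq mat2_zero)
      have "q = \<zero>" "s = \<zero>"
        using cancel[OF eqs(1,5)] cancel[OF eqs(3,7)] ne pqrs pqrs' car by auto
      moreover have "p = \<zero>" "r = \<zero>"
        using cancel[of q d p b q' b'] cancel[of s d r b s' b'] eqs ne pqrs pqrs' car
        by (auto simp: a_comm)
      ultimately show ?thesis
        using eqs pqrs pqrs' car by (simp add: \<alpha>_eq \<beta>_eq mat2_zero)
    qed
  qed
qed

text \<open>Every matrix lies in some minimal polynomial class, so the null ideal of S is the
  intersection of the null ideals of its parts, and an intersection of two-sided ideals is
  one.\<close>

lemma purely_core_imp_core:
  assumes S: "S \<subseteq> carrier (mat2_ring R)" and pure: "purely_core R S"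
  shows "core R S"
proof -
  interpret M: UP_ring "mat2_ring R" "UP (mat2_ring R)"
    by (simp add: UP_ring.intro ring_mat2)
  let ?N = "\<lambda>m. null_ideal R (S \<inter> min_poly_class R m)"
  \<comment> \<open>Any monic polynomial will do: it makes the intersected family nonempty and puts
    f into the polynomial ring.\<close>
  obtain n where n: "monic R n"
    using ex_monic_quadratic by blast
  have "f \<in> null_ideal R S \<longleftrightarrow> (\<forall>m. monic R m \<longrightarrow> f \<in> ?N m)" for f
  proof
    assume f: "\<forall>m. monic R m \<longrightarrow> f \<in> ?N m"
    have "eval (mat2_ring R) (mat2_ring R) id A f = \<zero>\<^bsub>mat2_ring R\<^esub>" if "A \<in> S" for A
    proof -
      have A: "A \<in> carrier (mat2_ring R)"
        using S that by blast
      then obtain m where "is_min_poly R A m"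
        using ex_is_min_poly by blast
      then have "monic R m" "A \<in> S \<inter> min_poly_class R m"
        using A that by (simp_all add: min_poly_class_def is_min_poly_def)
      then show ?thesis
        using f unfolding null_ideal_def by blast
    qed
    then show "f \<in> null_ideal R S"
      using f n unfolding null_ideal_def by blast
  qed (simp add: null_ideal_def)
  then have "null_ideal R S = \<Inter> (?N ` {m. monic R m})"
    by blast
  also have "ideal \<dots> (UP (mat2_ring R))"
  proof (rule M.P.i_Intersect)
    show "ideal I (UP (mat2_ring R))" if "I \<in> ?N ` {m. monic R m}" for I
      using that pure unfolding purely_core_def core_def by blast
  qed (use n in blast)
  finally show ?thesis
    by (simp add: core_def)
qed

section \<open>Families with prescribed trace and determinant\<close>

lemma minus_zero_iff:
  assumes "x \<in> carrier R" "y \<in> carrier R"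
  shows "x \<ominus> y = \<zero> \<longleftrightarrow> x = y"
proof
  assume "x \<ominus> y = \<zero>"
  moreover have "x = (x \<ominus> y) \<oplus> y"
    using assms by algebra
  ultimately show "x = y"
    using assms by simp
qed (use assms in \<open>simp add: minus_eq r_neg\<close>)

text \<open>A quadratic has at most two roots: distinct roots x and y satisfy x + y = t, so three
  roots would give y + x = z + x with y and z distinct.\<close>

lemma ex_nonroot_quadratic:
  assumes t: "t \<in> carrier R" and e: "e \<in> carrier R" and card: "3 \<le> card (carrier R)"
  shows "\<exists>a\<in>carrier R. a \<otimes> (t \<ominus> a) \<ominus> e \<noteq> \<zero>"
proof (rule ccontr)
  assume none: "\<not> ?thesis"
  have sum: "x \<oplus> y = t" if "x \<in> carrier R" "y \<in> carrier R" "x \<noteq> y" for x y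
  proof -
    have "(x \<ominus> y) \<otimes> (t \<ominus> (x \<oplus> y)) = (x \<otimes> (t \<ominus> x) \<ominus> e) \<ominus> (y \<otimes> (t \<ominus> y) \<ominus> e)"
      using that t e by algebra
    also have "\<dots> = \<zero>"
      using none that by (simp add: minus_eq)
    finally show ?thesis
      using that t integral[of "x \<ominus> y" "t \<ominus> (x \<oplus> y)"] minus_zero_iff[of x y] minus_zero_iff[of t "x \<oplus> y"]
      by auto
  qed
  obtain B where "B \<subseteq> carrier R" "card B = 3"
    by (rule obtain_subset_with_card_n[OF card])
  then obtain x y z where "x \<in> carrier R" "y \<in> carrier R" "z \<in> carrier R" "x \<noteq> y" "x \<noteq> z" "y \<noteq> z"
    by (auto simp: card_3_iff)
  then have "y \<oplus> x = z \<oplus> x" "x \<in> carrier R" "y \<in> carrier R" "z \<in> carrier R" "y \<noteq> z"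
    using sum[of y x] sum[of z x] by metis+
  then show False
    by simp
qed

text \<open>The off-diagonal entries of a matrix with trace \<open>t\<close>, determinant \<open>e\<close> and upper left entry \<open>a\<close>
  multiply to \<open>a (t - a) - e\<close>. When this is nonzero, two such matrices that differ are
  different in both off-diagonal entries.\<close>

definition slice :: "'a \<Rightarrow> 'a \<Rightarrow> ('a ^ 2 ^ 2) set" where
  "slice t e = (let a = SOME a. a \<in> carrier R \<and> a \<otimes> (t \<ominus> a) \<ominus> e \<noteq> \<zero> in
     (\<lambda>b. mat2 a b (inv b \<otimes> (a \<otimes> (t \<ominus> a) \<ominus> e)) (t \<ominus> a)) ` (carrier R - {\<zero>}))"

text \<open>\<open>ex_nonroot_quadratic\<close> justifies the choice inside \<open>slice\<close>; k
  is the common product of the off-diagonal entries.\<close>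

lemma slice_cases:
  assumes "t \<in> carrier R" "e \<in> carrier R" "3 \<le> card (carrier R)"
  obtains a k where "a \<in> carrier R" "k \<in> carrier R" "k \<noteq> \<zero>" "k = a \<otimes> (t \<ominus> a) \<ominus> e"
    "slice t e = (\<lambda>b. mat2 a b (inv b \<otimes> k) (t \<ominus> a)) ` (carrier R - {\<zero>})"
proof -
  define a where "a = (SOME a. a \<in> carrier R \<and> a \<otimes> (t \<ominus> a) \<ominus> e \<noteq> \<zero>)"
  have "a \<in> carrier R \<and> a \<otimes> (t \<ominus> a) \<ominus> e \<noteq> \<zero>"
    unfolding a_def using ex_nonroot_quadratic[OF assms] by (rule someI2_bex) blast
  then show ?thesis
    using assms by (intro that[of a "a \<otimes> (t \<ominus> a) \<ominus> e"]) (auto simp: slice_def a_def[symmetric])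
qed

lemma card_slice:
  assumes "t \<in> carrier R" "e \<in> carrier R" "3 \<le> card (carrier R)"
  shows "card (slice t e) = card (carrier R) - 1"
proof -
  obtain a k where "a \<in> carrier R" "k \<in> carrier R" "k \<noteq> \<zero>" "k = a \<otimes> (t \<ominus> a) \<ominus> e"
    "slice t e = (\<lambda>b. mat2 a b (inv b \<otimes> k) (t \<ominus> a)) ` (carrier R - {\<zero>})"
    by (rule slice_cases[OF assms])
  moreover have "inj_on (\<lambda>b. mat2 a b (inv b \<otimes> k) (t \<ominus> a)) (carrier R - {\<zero>})"
    by (auto simp: inj_on_def)
  ultimately have "card (slice t e) = card (carrier R - {\<zero>})"
    by (simp only: card_image)
  then show ?thesis
    by simp
qed

lemma slice_subset:
  assumes t: "t \<in> carrier R" and "e \<in> carrier R" "3 \<le> card (carrier R)"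
  shows "slice t e \<subseteq> carrier (mat2_ring R)"
proof -
  obtain a k where "a \<in> carrier R" "k \<in> carrier R" "k \<noteq> \<zero>" "k = a \<otimes> (t \<ominus> a) \<ominus> e"
    "slice t e = (\<lambda>b. mat2 a b (inv b \<otimes> k) (t \<ominus> a)) ` (carrier R - {\<zero>})"
    by (rule slice_cases[OF assms])
  then show ?thesis
    using t field_Units by auto
qed

text \<open>A class with a nonscalar member contains the whole slice for its trace and determinant.
  Two elements of S in that slice are a pair as in \<open>core_min_poly_class\<close>; the remaining
  classes fall under \<open>core_scalar\<close>.\<close>

lemma purely_coreI:
  assumes S: "S \<subseteq> carrier (mat2_ring R)" and card: "3 \<le> card (carrier R)"
    and slice: "\<And>t e. t \<in> carrier R \<Longrightarrow> e \<in> carrier R \<Longrightarrow> 2 \<le> card (S \<inter> slice t e)"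
  shows "purely_core R S"
  unfolding purely_core_def
proof (intro allI impI)
  fix m assume m: "monic R m"
  let ?T = "S \<inter> min_poly_class R m"
  show "core R ?T"
  proof (cases "?T \<subseteq> scalar_mat2 R ` carrier R")
    case True
    then show ?thesis by (rule core_scalar)
  next
    case False
    then obtain A where A: "A \<in> carrier (mat2_ring R)" "is_min_poly R A m" "A \<notin> scalar_mat2 R ` carrier R"
      by (auto simp: min_poly_class_def)
    then obtain w x y z where "A = mat2 w x y z" and
      wxyz: "w \<in> carrier R" "x \<in> carrier R" "y \<in> carrier R" "z \<in> carrier R"
      using mat2_cases by blast
    with A have "x \<noteq> \<zero> \<or> y \<noteq> \<zero> \<or> w \<noteq> z"
      by (auto simp: scalar_mat2_eq)
    then have deg: "deg R m = 2" and m1: "coeff (UP R) m 1 = \<ominus> (w \<oplus> z)"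
      and m0: "coeff (UP R) m 0 = w \<otimes> z \<ominus> x \<otimes> y"
      using is_min_poly_nonscalar[OF wxyz] A(2) \<open>A = _\<close> by auto
    define t where "t = w \<oplus> z"
    define e where "e = w \<otimes> z \<ominus> x \<otimes> y"
    have te: "t \<in> carrier R" "e \<in> carrier R"
      using wxyz by (auto simp: t_def e_def)
    obtain a k where a: "a \<in> carrier R" and k: "k \<in> carrier R" "k \<noteq> \<zero>" "k = a \<otimes> (t \<ominus> a) \<ominus> e"
      and slice_eq: "slice t e = (\<lambda>b. mat2 a b (inv b \<otimes> k) (t \<ominus> a)) ` (carrier R - {\<zero>})"
      by (rule slice_cases[OF te card])
    obtain W where "W \<subseteq> S \<inter> slice t e" "card W = 2"
      by (rule obtain_subset_with_card_n[OF slice[OF te]])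
    then obtain X Y where XY: "X \<in> S" "Y \<in> S" "X \<noteq> Y" "X \<in> slice t e" "Y \<in> slice t e"
      by (auto simp: card_2_iff)
    then obtain b b' where b: "b \<in> carrier R - {\<zero>}" "X = mat2 a b (inv b \<otimes> k) (t \<ominus> a)"
      and b': "b' \<in> carrier R - {\<zero>}" "Y = mat2 a b' (inv b' \<otimes> k) (t \<ominus> a)"
      unfolding slice_eq by blast
    have "b \<noteq> b'"
      using b b' XY by auto
    have inv: "inv b \<in> carrier R" "inv b' \<in> carrier R"
      using b b' field_Units by auto
    \<comment> \<open>Since k is nonzero, distinct upper right entries force distinct lower left
      ones, so the difference of X and Y is invertible.\<close>
    have "inv b \<otimes> k \<noteq> inv b' \<otimes> k"
    proof
      assume "inv b \<otimes> k = inv b' \<otimes> k"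
      then have "inv b = inv b'"
        using inv k(1,2) m_rcancel by blast
      then have "inv (inv b) = inv (inv b')"
        by simp
      then show False
        using \<open>b \<noteq> b'\<close> b(1) b'(1) by (simp add: field_Units)
    qed
    \<comment> \<open>Such a matrix has trace t and determinant a (t - a) - k = e, and a nonzero b
      makes it nonscalar.\<close>
    have "mat2 a b (inv b \<otimes> k) (t \<ominus> a) \<in> min_poly_class R m" if "b \<in> carrier R - {\<zero>}" for b
    proof -
      have inv: "inv b \<in> carrier R" and bb: "b \<otimes> inv b = \<one>"
        using that field_Units by auto
      have "b \<otimes> (inv b \<otimes> k) = k"
        using that inv k bb by (simp add: m_assoc[symmetric])
      then have "a \<otimes> (t \<ominus> a) \<ominus> b \<otimes> (inv b \<otimes> k) = e"
        using a te by (simp add: k(3)) algebra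
      moreover have "a \<oplus> (t \<ominus> a) = t"
        using a te by algebra
      ultimately show ?thesis
        using that inv k a te m deg m1 m0
        by (auto simp: min_poly_class_def is_min_poly_nonscalar t_def e_def)
    qed
    then have "X \<in> ?T" "Y \<in> ?T"
      using XY b b' by auto
    then show ?thesis
      unfolding b(2) b'(2)
      by (rule core_min_poly_class[OF Int_lower2]) fact+
  qed
qed

end

subsection \<open>Counting\<close>

text \<open>S is determined by its part in D, for which at most \<open>card D + 1\<close> choices
  remain, and by its part outside D, which is arbitrary.\<close>

lemma card_subsets_meeting_in_at_most_one:
  assumes M: "finite M" and D: "D \<subseteq> M"
  shows "card {S. S \<subseteq> M \<and> card (S \<inter> D) < 2} \<le> (card D + 1) * 2 ^ (card M - card D)"
proof -
  have fin: "finite D" "finite (M - D)"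
    using M D finite_subset by auto
  let ?T = "insert {} ((\<lambda>x. {x}) ` D) \<times> Pow (M - D)"
  have "card {S. S \<subseteq> M \<and> card (S \<inter> D) < 2} \<le> card ?T"
  proof (rule card_inj_on_le)
    show "inj_on (\<lambda>S. (S \<inter> D, S - D)) {S. S \<subseteq> M \<and> card (S \<inter> D) < 2}"
      by (rule inj_onI) blast
    show "(\<lambda>S. (S \<inter> D, S - D)) ` {S. S \<subseteq> M \<and> card (S \<inter> D) < 2} \<subseteq> ?T"
    proof (intro image_subsetI, elim CollectE conjE)
      fix S assume S: "S \<subseteq> M" "card (S \<inter> D) < 2"
      have "finite (S \<inter> D)"
        using fin by simp
      moreover have "card (S \<inter> D) = 0 \<or> card (S \<inter> D) = 1"
        using S(2) by linarith
      ultimately have "S \<inter> D \<in> insert {} ((\<lambda>x. {x}) ` D)"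
        by (auto simp: card_1_singleton_iff)
      then show "(S \<inter> D, S - D) \<in> ?T"
        using S(1) by auto
    qed
    show "finite ?T"
      using fin by auto
  qed
  also have "\<dots> = card (insert {} ((\<lambda>x. {x}) ` D)) * 2 ^ card (M - D)"
    using fin by (simp only: card_cartesian_product card_Pow)
  also have "card (insert {} ((\<lambda>x. {x}) ` D)) \<le> card D + 1"
    using fin card_image_le[of D "\<lambda>x. {x}"] by (auto simp: card_insert_if)
  also have "card (M - D) = card M - card D"
    using fin D by (intro card_Diff_subset)
  finally show ?thesis
    by simp
qed

lemma finite_mat2_carrier:
  assumes "finite (carrier R)"
  shows "finite (carrier (mat2_ring R))"
proof (rule finite_subset)
  let ?C = "carrier R"
  show "finite ((\<lambda>(a, b, c, d). mat2 a b c d) ` (?C \<times> ?C \<times> ?C \<times> ?C))"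
    using assms by simp
  show "carrier (mat2_ring R) \<subseteq> (\<lambda>(a, b, c, d). mat2 a b c d) ` (?C \<times> ?C \<times> ?C \<times> ?C)"
  proof
    fix A assume "A \<in> carrier (mat2_ring R)"
    then obtain a b c d where "A = mat2 a b c d" "a \<in> ?C" "b \<in> ?C" "c \<in> ?C" "d \<in> ?C" ..
    then show "A \<in> (\<lambda>(a, b, c, d). mat2 a b c d) ` (?C \<times> ?C \<times> ?C \<times> ?C)"
      by (intro image_eqI[of _ _ "(a, b, c, d)"]) auto
  qed
qed

section \<open>Proportions over a fixed finite field\<close>

context field
begin

text \<open>Union bound over the q^2 pairs (t, e): each slice is met in at most one matrix by a
  proportion of at most q / 2^(q - 1) of all subsets. The total q^3 / 2^(q - 1) is rewritten with
  denominator 2^q.\<close>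

lemma purely_core_proportion:
  assumes fin: "finite (carrier R)" and q: "card (carrier R) = q" "3 \<le> q"
  shows "1 - 2 * real q ^ 3 / 2 ^ q
    \<le> real (card (purely_core_subsets R)) / real (card (Pow (carrier (mat2_ring R))))"
proof -
  let ?C = "carrier R" and ?M = "carrier (mat2_ring R)"
  let ?few = "\<lambda>(t, e). {S. S \<subseteq> ?M \<and> card (S \<inter> slice t e) < 2}"
  have finM: "finite ?M"
    using fin by (rule finite_mat2_carrier)
  have bound: "card (?few p) \<le> q * 2 ^ (card ?M - (q - 1))" if mem: "p \<in> ?C \<times> ?C" for p
  proof -
    obtain t e where p: "p = (t, e)" "t \<in> ?C" "e \<in> ?C"
      using mem by blast
    \<comment> \<open>With q - 1 elements in a slice, the factor \<open>card D + 1\<close> of the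
      counting lemma is exactly q.\<close>
    have card: "card (slice t e) = q - 1"
      using card_slice[OF p(2,3)] q by simp
    have "slice t e \<subseteq> ?M"
      using slice_subset[OF p(2,3)] q by simp
    from card_subsets_meeting_in_at_most_one[OF finM this]
    show ?thesis
      unfolding card p(1) using q by simp
  qed
  \<comment> \<open>Subtraction on naturals truncates. The inequality makes the exponent
    \<open>card ?M - (q - 1)\<close> a true difference, so the power of 2 splits.\<close>
  have "q - 1 \<le> card ?M"
  proof -
    have "slice \<zero> \<zero> \<subseteq> ?M" "card (slice \<zero> \<zero>) = q - 1"
      using slice_subset[of \<zero> \<zero>] card_slice[of \<zero> \<zero>] q by simp_all
    then show ?thesis
      using card_mono[OF finM] by metis
  qed
  then have "card ?M = card ?M - (q - 1) + (q - 1)"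
    by simp
  then have pow: "(2::real) ^ card ?M = 2 ^ (card ?M - (q - 1)) * 2 ^ (q - 1)"
    by (metis power_add)
  have pow_q: "(2::real) ^ q = 2 * 2 ^ (q - 1)"
    using q by (simp add: power_eq_if)
  have "Pow ?M \<subseteq> purely_core_subsets R \<union> (\<Union>p\<in>?C \<times> ?C. ?few p)"
  proof
    fix S assume "S \<in> Pow ?M"
    then have S: "S \<subseteq> ?M" by simp
    show "S \<in> purely_core_subsets R \<union> (\<Union>p\<in>?C \<times> ?C. ?few p)"
    proof (cases "\<forall>t\<in>?C. \<forall>e\<in>?C. 2 \<le> card (S \<inter> slice t e)")
      case True
      then have "purely_core R S"
        using S q by (intro purely_coreI) auto
      then show ?thesis
        using S by (simp add: purely_core_subsets_def)
    next
      case False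
      then obtain t e where "t \<in> ?C" "e \<in> ?C" "card (S \<inter> slice t e) < 2"
        by (meson not_le)
      then have "S \<in> ?few (t, e)" "(t, e) \<in> ?C \<times> ?C"
        using S by auto
      then show ?thesis
        by blast
    qed
  qed
  moreover have fins: "finite (purely_core_subsets R)" "finite (\<Union>p\<in>?C \<times> ?C. ?few p)"
    using finM by (auto intro: finite_subset[of _ "Pow ?M"] simp: purely_core_subsets_def)
  ultimately have "card (Pow ?M) \<le> card (purely_core_subsets R \<union> (\<Union>p\<in>?C \<times> ?C. ?few p))"
    by (intro card_mono) auto
  also have "\<dots> \<le> card (purely_core_subsets R) + card (\<Union>p\<in>?C \<times> ?C. ?few p)"
    by (rule card_Un_le)
  also have "card (\<Union>p\<in>?C \<times> ?C. ?few p) \<le> (\<Sum>p\<in>?C \<times> ?C. card (?few p))"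
    using fin by (intro card_UN_le) simp
  also have "\<dots> \<le> (\<Sum>p\<in>?C \<times> ?C. q * 2 ^ (card ?M - (q - 1)))"
    by (intro sum_mono bound)
  also have "\<dots> = q ^ 3 * 2 ^ (card ?M - (q - 1))"
    using q by (simp add: card_cartesian_product power3_eq_cube)
  finally have "card (Pow ?M) \<le> card (purely_core_subsets R) + q ^ 3 * 2 ^ (card ?M - (q - 1))"
    by simp
  then have "real (card (Pow ?M)) \<le> real (card (purely_core_subsets R) + q ^ 3 * 2 ^ (card ?M - (q - 1)))"
    by (simp only: of_nat_le_iff)
  then have "1 \<le> (real (card (purely_core_subsets R)) + real q ^ 3 * 2 ^ (card ?M - (q - 1))) / real (card (Pow ?M))"
    using finM by (simp add: card_Pow)
  also have "\<dots> = real (card (purely_core_subsets R)) / real (card (Pow ?M)) + 2 * real q ^ 3 / 2 ^ q"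
    using finM by (simp add: card_Pow pow pow_q add_divide_distrib)
  finally show ?thesis
    by simp
qed

text \<open>These comparisons rest on purely core sets being core and core sets being subsets of the
  matrix ring. They transfer the lower bound to all three quotients.\<close>

lemma core_proportions:
  assumes fin: "finite (carrier R)"
  shows "real (card (purely_core_subsets R)) / real (card (Pow (carrier (mat2_ring R))))
      \<le> real (card (core_subsets R)) / real (card (Pow (carrier (mat2_ring R))))"
    and "real (card (purely_core_subsets R)) / real (card (Pow (carrier (mat2_ring R))))
      \<le> real (card (purely_core_subsets R)) / real (card (core_subsets R))"
    and "real (card (core_subsets R)) / real (card (Pow (carrier (mat2_ring R)))) \<le> 1"
    and "real (card (purely_core_subsets R)) / real (card (core_subsets R)) \<le> 1"
proof -
  let ?M = "carrier (mat2_ring R)"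
  have finM: "finite (Pow ?M)"
    using finite_mat2_carrier[OF fin] by simp
  have core: "core_subsets R \<subseteq> Pow ?M"
    by (auto simp: core_subsets_def)
  then have fin_core: "finite (core_subsets R)"
    using finM by (rule finite_subset)
  \<comment> \<open>The empty set is core, so the number of core subsets is a positive
    denominator.\<close>
  have "{} \<in> core_subsets R"
    by (simp add: core_subsets_def core_scalar)
  then have pos: "0 < card (core_subsets R)"
    using fin_core card_gt_0_iff by blast
  have le: "card (purely_core_subsets R) \<le> card (core_subsets R)"
    using fin_core purely_core_imp_core
    by (intro card_mono) (auto simp: core_subsets_def purely_core_subsets_def)
  have le': "card (core_subsets R) \<le> card (Pow ?M)"
    using finM core by (rule card_mono)
  show "real (card (purely_core_subsets R)) / real (card (Pow ?M)) \<le> real (card (core_subsets R)) / real (card (Pow ?M))"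
    using le by (intro divide_right_mono) auto
  show "real (card (purely_core_subsets R)) / real (card (Pow ?M))
      \<le> real (card (purely_core_subsets R)) / real (card (core_subsets R))"
    using le' pos by (intro divide_left_mono) auto
  show "real (card (core_subsets R)) / real (card (Pow ?M)) \<le> 1"
    using le' pos by (simp add: divide_le_eq_1 del: card_Pow)
  show "real (card (purely_core_subsets R)) / real (card (core_subsets R)) \<le> 1"
    using le pos by simp
qed

end

section \<open>The limit along prime powers\<close>

lemma eventually_at_top_primepow:
  "eventually P at_top_primepow \<longleftrightarrow> eventually (\<lambda>q. primepow q \<longrightarrow> P q) at_top"
  by (simp add: at_top_primepow_def eventually_inf_principal)

theorem theorem5:
  fixes F :: "nat \<Rightarrow> 'a ring"
  assumes "\<And>q. primepow q \<Longrightarrow> field (F q)"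
    and "\<And>q. primepow q \<Longrightarrow> finite (carrier (F q))"
    and "\<And>q. primepow q \<Longrightarrow> card (carrier (F q)) = q"
  shows "((\<lambda>q. real (card (purely_core_subsets (F q))) / real (card (Pow (carrier (mat2_ring (F q))))))
            \<longlongrightarrow> 1) at_top_primepow
    \<and> ((\<lambda>q. real (card (purely_core_subsets (F q))) / real (card (core_subsets (F q))))
            \<longlongrightarrow> 1) at_top_primepow
    \<and> ((\<lambda>q. real (card (core_subsets (F q))) / real (card (Pow (carrier (mat2_ring (F q))))))
            \<longlongrightarrow> 1) at_top_primepow"
proof -
  let ?pt = "\<lambda>q. real (card (purely_core_subsets (F q))) / real (card (Pow (carrier (mat2_ring (F q)))))"
  let ?pc = "\<lambda>q. real (card (purely_core_subsets (F q))) / real (card (core_subsets (F q)))"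
  let ?ct = "\<lambda>q. real (card (core_subsets (F q))) / real (card (Pow (carrier (mat2_ring (F q)))))"
  let ?low = "\<lambda>q. 1 - 2 * real q ^ 3 / 2 ^ q"
  have "?low \<longlonglongrightarrow> 1"
    by real_asymp
  then have low: "(?low \<longlongrightarrow> 1) at_top_primepow"
    by (rule tendsto_mono[rotated]) (simp add: at_top_primepow_def)
  \<comment> \<open>Only the prime power 2 is discarded, where a quadratic may vanish on the whole
    field.\<close>
  have ev: "eventually P at_top_primepow" if "\<And>q. primepow q \<Longrightarrow> 3 \<le> q \<Longrightarrow> P q" for P
    unfolding eventually_at_top_primepow using eventually_ge_at_top[of "3::nat"]
    by eventually_elim (use that in blast)
  note le = field.core_proportions[OF assms(1,2)]
  have pt: "?low q \<le> ?pt q" if "primepow q" "3 \<le> q" for q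
    using field.purely_core_proportion[OF assms] that by blast
  have "?pt q \<le> 1" if "primepow q" for q
    using le(1,3)[OF that that] by linarith
  then have 1: "(?pt \<longlongrightarrow> 1) at_top_primepow"
    by (intro tendsto_sandwich[OF _ _ low tendsto_const] ev pt)
  \<comment> \<open>Both remaining quotients lie between the first one and 1, so its limit squeezes
    them.\<close>
  have 2: "(?pc \<longlongrightarrow> 1) at_top_primepow"
    using le(2,4) by (intro tendsto_sandwich[OF _ _ 1 tendsto_const] ev)
  have 3: "(?ct \<longlongrightarrow> 1) at_top_primepow"
    using le(1,3) by (intro tendsto_sandwich[OF _ _ 1 tendsto_const] ev)
  show ?thesis
    using 1 2 3 by blast
qed

end
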